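(* Let $R\in\mathbb{C}^{M\times M}$ be Hermitian, let $\mathcal{B}=\operatorname{span}\{B_1,\ldots,B_d\}\subseteq\mathbb{C}^{M\times M}$ with $B_1,\dots,B_d$ linearly independent, and let $\lambda_1\le\cdots\le\lambda_d$ be the generalized eigenvalues of $\mathbf{M}\mathbf{c}=\lambda\mathbf{G}\mathbf{c}$, where $\mathbf{M}_{ij}=\operatorname{Tr}(B_i^H[R,[R,B_j]])$ and $\mathbf{G}_{ij}=\operatorname{Tr}(B_i^HB_j)$. Then: (i) $\lambda_k\ge 0$ for all $k$; (ii) $\lambda_1=0$ if and only if $R$ commutes with some nonzero $A\in\mathcal{B}$; (iii) $\lambda_d\le 4\|R\|_2^2$; (iv) if $R=\sigma^2\mathbf{I}$, then $\lambda_k=0$ for all $k$.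
   Context: $[X,Y]=XY-YX$; $X^H$ is the conjugate transpose; $\|\cdot\|_2$ is the spectral (operator) norm; $\mathbf{I}$ is the identity matrix. *)

theory Defs
  imports "HOL-Analysis.Analysis" "HOL-Computational_Algebra.Polynomial"
begin

definition commutator :: "complex^'m^'m \<Rightarrow> complex^'m^'m \<Rightarrow> complex^'m^'m" where
  "commutator X Y = X ** Y - Y ** X"

definition conj_transpose :: "complex^'n^'m \<Rightarrow> complex^'m^'n" where
  "conj_transpose X = (\<chi> i j. cnj (X $ j $ i))"

definition hermitian :: "complex^'m^'m \<Rightarrow> bool" where
  "hermitian X \<longleftrightarrow> conj_transpose X = X"

text \<open>
  The norm of \<^typ>\<open>complex^'m\<close> is the Euclidean one, so this is the operator norm
  induced by the 2-norm.
\<close>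

definition spectral_norm :: "complex^'m^'m \<Rightarrow> real" where
  "spectral_norm A = onorm ((*v) A)"

text \<open>
  The library only has the real scalar multiplication on nested vectors; span and linear
  independence of matrices are needed over the complex numbers.
\<close>

definition mat_scale :: "complex \<Rightarrow> complex^'n^'m \<Rightarrow> complex^'n^'m" where
  "mat_scale c A = (\<chi> i j. c * A $ i $ j)"

interpretation cmat: vector_space "mat_scale :: complex \<Rightarrow> complex^'n^'m \<Rightarrow> complex^'n^'m"
  by unfold_locales (simp_all add: mat_scale_def vec_eq_iff algebra_simps)

definition lin_indep_family :: "('d \<Rightarrow> complex^'n^'m) \<Rightarrow> bool" where
  "lin_indep_family B \<longleftrightarrow> inj B \<and> cmat.independent (range B)"

definition gram_matrix :: "('d::finite \<Rightarrow> complex^'m^'m) \<Rightarrow> complex^'d^'d" where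
  "gram_matrix B = (\<chi> i j. trace (conj_transpose (B i) ** B j))"

definition commutator_matrix ::
    "complex^'m^'m \<Rightarrow> ('d::finite \<Rightarrow> complex^'m^'m) \<Rightarrow> complex^'d^'d" where
  "commutator_matrix R B =
     (\<chi> i j. trace (conj_transpose (B i) ** commutator R (commutator R (B j))))"

text \<open>
  Generalized eigenvalues of \<open>A c = \<lambda> G c\<close>, repeated according to algebraic multiplicity,
  i.e. the roots of the polynomial \<open>det (\<lambda> G - A)\<close> in \<open>\<lambda>\<close>. The definition is meant for
  nonsingular \<open>G\<close>: the zero polynomial has the empty multiset of roots.
\<close>

definition pencil_poly :: "complex^'d^'d \<Rightarrow> complex^'d^'d \<Rightarrow> complex poly" where
  "pencil_poly A G = det (\<chi> i j. [:- A $ i $ j, G $ i $ j:])"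

definition gen_eigenvalues :: "complex^'d^'d \<Rightarrow> complex^'d^'d \<Rightarrow> complex multiset" where
  "gen_eigenvalues A G = proots (pencil_poly A G)"

text \<open>
  \<open>lam 1 \<le> \<dots> \<le> lam d\<close> are the generalized eigenvalues with multiplicity; in particular all
  of them are real and there are exactly \<open>d\<close>. Values of \<open>lam\<close> outside \<open>{1..d}\<close> are irrelevant.
\<close>

definition ordered_gen_eigenvalues ::
    "complex^'d^'d \<Rightarrow> complex^'d^'d \<Rightarrow> (nat \<Rightarrow> real) \<Rightarrow> bool" where
  "ordered_gen_eigenvalues A G lam \<longleftrightarrow>
     mono_on {1..CARD('d)} lam \<and>
     image_mset (\<lambda>k. complex_of_real (lam k)) (mset_set {1..CARD('d)}) = gen_eigenvalues A G"

lemma poly_pencil_poly: "poly (pencil_poly A G) z = det (mat_scale z G - A)"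
  by (simp add: pencil_poly_def det_def poly_sum poly_prod mat_scale_def of_int_poly algebra_simps)

lemma gen_eigenvalues_iff:
  assumes "pencil_poly A G \<noteq> 0"
  shows "z \<in># gen_eigenvalues A G \<longleftrightarrow> (\<exists>c. c \<noteq> 0 \<and> A *v c = z *s (G *v c))"
proof -
  have eq: "(mat_scale z G - A) *v c = z *s (G *v c) - A *v c" for c
    by (simp add: vec_eq_iff matrix_vector_mult_def mat_scale_def sum_distrib_left
        sum_subtractf algebra_simps)
  have "z \<in># gen_eigenvalues A G \<longleftrightarrow> det (mat_scale z G - A) = 0"
    using assms by (simp add: gen_eigenvalues_def poly_pencil_poly)
  also have "\<dots> \<longleftrightarrow> \<not> (\<forall>c. (mat_scale z G - A) *v c = 0 \<longrightarrow> c = 0)"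
    by (metis invertible_det_nz invertible_left_inverse matrix_left_invertible_ker)
  also have "\<dots> \<longleftrightarrow> (\<exists>c. c \<noteq> 0 \<and> A *v c = z *s (G *v c))"
    unfolding eq right_minus_eq by metis
  finally show ?thesis .
qed

end

theory Submission
  imports Defs "HOL-Computational_Algebra.Fundamental_Theorem_Algebra"
begin

text \<open>
  For \<open>A = (\<Sum>j. c\<^sub>j B\<^sub>j)\<close> and Hermitian \<open>R\<close> the two quadratic forms are squared Frobenius norms,
  \<open>c\<^sup>H M c = \<parallel>[R, A]\<parallel>\<^sup>2\<close> and \<open>c\<^sup>H G c = \<parallel>A\<parallel>\<^sup>2\<close>. Hence \<open>G\<close> is nonsingular, the pencil polynomial has
  degree \<open>d\<close>, and every one of its roots equals \<open>\<parallel>[R, A]\<parallel>\<^sup>2 / \<parallel>A\<parallel>\<^sup>2\<close> for some nonzero \<open>A\<close> in the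
  span. All claims are read off this quotient, (iii) using \<open>\<parallel>R A\<parallel>, \<parallel>A R\<parallel> \<le> \<parallel>R\<parallel>\<^sub>2 \<parallel>A\<parallel>\<close>.
\<close>

section \<open>The Hilbert-Schmidt inner product, conjugate-linear on the left, and
  coordinates\<close>

definition hs_inner :: "complex^'n^'m \<Rightarrow> complex^'n^'m \<Rightarrow> complex" where
  "hs_inner X Y = trace (conj_transpose X ** Y)"

definition lin_comb :: "('d::finite \<Rightarrow> complex^'n^'m) \<Rightarrow> complex^'d \<Rightarrow> complex^'n^'m" where
  "lin_comb B c = (\<Sum>j\<in>UNIV. mat_scale (c $ j) (B j))"

lemma hs_inner_eq_sum: "hs_inner X Y = (\<Sum>i\<in>UNIV. \<Sum>j\<in>UNIV. cnj (X $ i $ j) * Y $ i $ j)"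
  unfolding hs_inner_def trace_def conj_transpose_def matrix_matrix_mult_def
  by (simp, rule sum.swap)

lemma hs_inner_add_right: "hs_inner X (Y + Z) = hs_inner X Y + hs_inner X Z"
  by (simp add: hs_inner_eq_sum algebra_simps sum.distrib)

lemma hs_inner_diff_left: "hs_inner (X - Y) Z = hs_inner X Z - hs_inner Y Z"
  by (simp add: hs_inner_eq_sum algebra_simps sum_subtractf)

lemma hs_inner_diff_right: "hs_inner X (Y - Z) = hs_inner X Y - hs_inner X Z"
  by (simp add: hs_inner_eq_sum algebra_simps sum_subtractf)

lemma hs_inner_add_left: "hs_inner (X + Y) Z = hs_inner X Z + hs_inner Y Z"
  by (simp add: hs_inner_eq_sum algebra_simps sum.distrib)

lemma hs_inner_zero [simp]: "hs_inner 0 X = 0" "hs_inner X 0 = 0"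
  by (simp_all add: hs_inner_eq_sum)

lemma hs_inner_scale_right: "hs_inner X (mat_scale a Y) = a * hs_inner X Y"
  by (simp add: hs_inner_eq_sum mat_scale_def sum_distrib_left algebra_simps)

lemma hs_inner_scale_left: "hs_inner (mat_scale a X) Y = cnj a * hs_inner X Y"
  by (simp add: hs_inner_eq_sum mat_scale_def sum_distrib_left algebra_simps)

lemma hs_inner_lin_comb_right:
  "hs_inner X (lin_comb B c) = (\<Sum>j\<in>UNIV. hs_inner X (B j) * c $ j)"
proof -
  have "hs_inner X (\<Sum>j\<in>S. mat_scale (c $ j) (B j)) = (\<Sum>j\<in>S. hs_inner X (B j) * c $ j)" for S
    by (induction S rule: infinite_finite_induct)
      (simp_all add: hs_inner_add_right hs_inner_scale_right)
  then show ?thesis by (simp add: lin_comb_def)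
qed

lemma hs_inner_lin_comb_left:
  "hs_inner (lin_comb B c) X = (\<Sum>j\<in>UNIV. cnj (c $ j) * hs_inner (B j) X)"
proof -
  have "hs_inner (\<Sum>j\<in>S. mat_scale (c $ j) (B j)) X = (\<Sum>j\<in>S. cnj (c $ j) * hs_inner (B j) X)" for S
    by (induction S rule: infinite_finite_induct)
      (simp_all add: hs_inner_add_left hs_inner_scale_left)
  then show ?thesis by (simp add: lin_comb_def)
qed

section \<open>Frobenius norm estimates\<close>

text \<open>The norm on nested vectors is Euclidean at both levels, hence is the Frobenius
  norm.\<close>

lemma power2_norm_matrix:
  fixes X :: "complex^'n^'m"
  shows "(norm X)\<^sup>2 = (\<Sum>i\<in>UNIV. \<Sum>j\<in>UNIV. (cmod (X $ i $ j))\<^sup>2)"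
  by (simp add: norm_vec_def L2_set_def sum_nonneg)

lemma hs_inner_self: "hs_inner X X = of_real ((norm X)\<^sup>2)"
  by (simp add: hs_inner_eq_sum power2_norm_matrix complex_norm_square mult.commute
      del: of_real_power)

lemma power2_norm_matrix_columns:
  fixes X :: "complex^'n^'m"
  shows "(norm X)\<^sup>2 = (\<Sum>j\<in>UNIV. (norm (column j X))\<^sup>2)"
proof -
  have "(norm (column j X))\<^sup>2 = (\<Sum>i\<in>UNIV. (cmod (X $ i $ j))\<^sup>2)" for j
    by (simp add: norm_vec_def L2_set_def sum_nonneg column_def)
  then show ?thesis
    unfolding power2_norm_matrix by simp (rule sum.swap)
qed

lemma norm_conj_transpose [simp]: "norm (conj_transpose X) = norm X"
proof -
  have "(norm (conj_transpose X))\<^sup>2 = (norm X)\<^sup>2"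
    unfolding power2_norm_matrix conj_transpose_def by (simp, rule sum.swap)
  then show ?thesis by simp
qed

lemma conj_transpose_mult:
  "conj_transpose (X ** Y) = conj_transpose Y ** conj_transpose X"
  by (simp add: vec_eq_iff conj_transpose_def matrix_matrix_mult_def mult.commute)

lemma spectral_norm_nonneg: "0 \<le> spectral_norm A"
  unfolding spectral_norm_def by (intro onorm_pos_le matrix_vector_mul_bounded_linear)

text \<open>Left multiplication by \<open>A\<close> acts on each column of \<open>X\<close>
  separately, so the operator norm bound is applied per column and the squares are added.\<close>

lemma norm_matrix_mult_left_le:
  fixes A X :: "complex^'m^'m"
  shows "norm (A ** X) \<le> spectral_norm A * norm X"
proof -
  have col: "column j (A ** X) = A *v column j X" for j
    by (simp add: vec_eq_iff column_def matrix_matrix_mult_def matrix_vector_mult_def)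
  have "norm (A *v x) \<le> spectral_norm A * norm x" for x
    unfolding spectral_norm_def by (intro onorm matrix_vector_mul_bounded_linear)
  then have "(norm (A *v x))\<^sup>2 \<le> (spectral_norm A)\<^sup>2 * (norm x)\<^sup>2" for x
    by (metis norm_ge_zero power_mono power_mult_distrib)
  then have "(norm (A ** X))\<^sup>2 \<le> (\<Sum>j\<in>UNIV. (spectral_norm A)\<^sup>2 * (norm (column j X))\<^sup>2)"
    unfolding power2_norm_matrix_columns col by (intro sum_mono)
  also have "\<dots> = (spectral_norm A * norm X)\<^sup>2"
    by (simp add: power2_norm_matrix_columns[of X] power_mult_distrib sum_distrib_left)
  finally show ?thesis
    by (rule power2_le_imp_le) (simp add: spectral_norm_nonneg)
qed

text \<open>The product \<open>A ** R\<close> has \<open>R\<close> on the wrong side for the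
  previous bound; taking adjoints, with \<open>R\<close> Hermitian, turns it into
  \<open>R ** conj_transpose A\<close> of equal norm.\<close>

lemma norm_commutator_le:
  fixes R A :: "complex^'m^'m"
  assumes "hermitian R"
  shows "norm (commutator R A) \<le> 2 * spectral_norm R * norm A"
proof -
  have "norm (A ** R) = norm (R ** conj_transpose A)"
    using assms by (metis conj_transpose_mult hermitian_def norm_conj_transpose)
  also have "\<dots> \<le> spectral_norm R * norm A"
    using norm_matrix_mult_left_le[of R "conj_transpose A"] by simp
  finally have "norm (A ** R) \<le> spectral_norm R * norm A" .
  then show ?thesis
    using norm_matrix_mult_left_le[of R A] norm_triangle_ineq4[of "R ** A" "A ** R"]
    by (simp add: commutator_def)
qed

section \<open>Linearity and self-adjointness of the commutator map\<close>

lemma commutator_eq_0_iff: "commutator R A = 0 \<longleftrightarrow> R ** A = A ** R"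
  by (simp add: commutator_def)

lemma commutator_zero_right [simp]: "commutator R 0 = 0"
  by (simp add: commutator_def vec_eq_iff matrix_matrix_mult_def)

lemma commutator_lin_comb:
  "commutator R (lin_comb B c) = lin_comb (\<lambda>j. commutator R (B j)) c"
proof -
  have add: "commutator R (X + Y) = commutator R X + commutator R Y" for X Y
    by (simp add: commutator_def vec_eq_iff matrix_matrix_mult_def algebra_simps sum.distrib)
  have scale: "commutator R (mat_scale a X) = mat_scale a (commutator R X)" for a X
    by (simp add: commutator_def vec_eq_iff matrix_matrix_mult_def mat_scale_def
        algebra_simps sum_distrib_left)
  have "commutator R (\<Sum>j\<in>S. mat_scale (c $ j) (B j))
      = (\<Sum>j\<in>S. mat_scale (c $ j) (commutator R (B j)))" for S
    by (induction S rule: infinite_finite_induct) (simp_all add: add scale)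
  then show ?thesis by (simp add: lin_comb_def)
qed

text \<open>Left multiplication by \<open>R\<close> is self-adjoint because \<open>R\<close> is
  Hermitian; right multiplication needs cyclicity of the trace in addition.\<close>

lemma hs_inner_commutator_right:
  assumes "hermitian R"
  shows "hs_inner X (commutator R Y) = hs_inner (commutator R X) Y"
proof -
  have "hs_inner X (R ** Y) = hs_inner (R ** X) Y"
    using assms by (simp add: hs_inner_def conj_transpose_mult hermitian_def matrix_mul_assoc)
  moreover have "hs_inner X (Y ** R) = hs_inner (X ** R) Y"
    unfolding hs_inner_def conj_transpose_mult
    using assms by (metis hermitian_def matrix_mul_assoc trace_mul_sym)
  ultimately show ?thesis
    by (simp add: commutator_def hs_inner_diff_left hs_inner_diff_right)
qed

section \<open>The two matrices, the span and independence in coordinates\<close>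

lemma gram_matrix_vector:
  "(gram_matrix B *v c) $ i = hs_inner (B i) (lin_comb B c)"
  by (simp add: gram_matrix_def matrix_vector_mult_def hs_inner_lin_comb_right)
    (simp add: hs_inner_def)

lemma commutator_matrix_vector:
  "(commutator_matrix R B *v c) $ i
    = hs_inner (B i) (commutator R (commutator R (lin_comb B c)))"
  by (simp add: commutator_matrix_def matrix_vector_mult_def commutator_lin_comb
      hs_inner_lin_comb_right) (simp add: hs_inner_def)

lemma span_eq_range_lin_comb: "cmat.span (range B) = range (lin_comb B)"
proof
  show "range (lin_comb B) \<subseteq> cmat.span (range B)"
    by (auto simp: lin_comb_def cmat.span_base intro!: cmat.span_sum cmat.span_scale)
  have "\<exists>c. A = lin_comb B c" if "A \<in> cmat.span (range B)" for A
    using that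
  proof (induction rule: cmat.span_induct_alt)
    case base
    have "0 = lin_comb B 0" by (simp add: lin_comb_def)
    then show ?case ..
  next
    case (step a X Y)
    then obtain i c where "X = B i" "Y = lin_comb B c" by auto
    \<comment> \<open>Adding \<open>axis i a\<close> raises the coefficient of \<open>B i\<close> by
      \<open>a\<close>.\<close>
    then have "mat_scale a X + Y = lin_comb B (axis i a + c)"
      by (simp add: lin_comb_def axis_def cmat.scale_left_distrib sum.distrib
          if_distrib[of "\<lambda>z. mat_scale z _"] cong: if_cong)
    then show ?case ..
  qed
  then show "cmat.span (range B) \<subseteq> range (lin_comb B)" by auto
qed

lemma lin_comb_eq_0_iff:
  assumes "lin_indep_family B"
  shows "lin_comb B c = 0 \<longleftrightarrow> c = 0"
proof
  assume c: "lin_comb B c = 0"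
  have inj: "inj B" and ind: "cmat.independent (range B)"
    using assms by (auto simp: lin_indep_family_def)
  \<comment> \<open>Independence is stated for the set \<open>range B\<close>, so the sum is
    reindexed from indices to matrices; injectivity makes \<open>inv B\<close> recover the
    index.\<close>
  have "(\<Sum>v\<in>range B. mat_scale (c $ inv B v) v) = 0"
    using c inj by (simp add: sum.reindex lin_comb_def)
  then have "c $ inv B v = 0" if "v \<in> range B" for v
    using ind that cmat.dependent_finite[of "range B"] by auto
  then show "c = 0" using inj by (metis inv_f_f rangeI vec_eq_iff zero_index)
qed (simp add: lin_comb_def)

text \<open>A kernel vector \<open>c\<close> gives a combination of squared norm \<open>0\<close>,
  and independence then forces \<open>c = 0\<close>.\<close>

lemma det_gram_matrix_nonzero:
  assumes "lin_indep_family B"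
  shows "det (gram_matrix B) \<noteq> 0"
proof -
  have "c = 0" if "gram_matrix B *v c = 0" for c
  proof -
    have "hs_inner (lin_comb B c) (lin_comb B c) = 0"
      using that by (subst hs_inner_lin_comb_left) (simp flip: gram_matrix_vector)
    then show ?thesis using assms by (simp add: hs_inner_self lin_comb_eq_0_iff)
  qed
  then show ?thesis
    by (metis invertible_det_nz invertible_left_inverse matrix_left_invertible_ker)
qed

section \<open>Degree and root count of the pencil polynomial\<close>

text \<open>Each Leibniz term is a product of \<open>CARD('d)\<close> polynomials of degree at most
  one; its top coefficient is the corresponding Leibniz term of \<open>det G\<close>.\<close>

lemma degree_pencil_poly_and_coeff:
  fixes A G :: "complex^'d^'d"
  shows "degree (pencil_poly A G) \<le> CARD('d) \<and> coeff (pencil_poly A G) CARD('d) = det G"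
proof -
  define P where "P = (\<lambda>p. \<Prod>i\<in>UNIV. [:- A $ i $ p i, G $ i $ p i:])"
  have pencil: "pencil_poly A G = (\<Sum>p | p permutes UNIV. smult (of_int (sign p)) (P p))"
    by (simp add: pencil_poly_def det_def P_def of_int_poly)
  have P: "degree (\<Prod>i\<in>S. [:a i, b i:]) \<le> card S \<and> coeff (\<Prod>i\<in>S. [:a i, b i:]) (card S) = prod b S"
    for S :: "'d set" and a b :: "'d \<Rightarrow> complex"
  proof (induction S rule: infinite_finite_induct)
    case (insert x S)
    \<comment> \<open>This coefficient lies above the degree, so \<open>a x\<close> contributes
      nothing to the top coefficient of the larger product.\<close>
    then have "coeff (\<Prod>i\<in>S. [:a i, b i:]) (Suc (card S)) = 0"
      by (intro coeff_eq_0) simp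
    moreover have "degree ([:a x, b x:] * (\<Prod>i\<in>S. [:a i, b i:])) \<le> Suc (card S)"
      using insert degree_mult_le[of "[:a x, b x:]" "\<Prod>i\<in>S. [:a i, b i:]"]
        degree_pCons_le[of "a x" "[:b x:]"] by simp
    ultimately show ?case using insert by (simp add: mult_pCons_left)
  qed simp_all
  have "degree (pencil_poly A G) \<le> CARD('d)"
    unfolding pencil P_def using P[where S = UNIV]
    by (intro degree_sum_le) (auto intro: order_trans[OF degree_smult_le])
  moreover have "coeff (pencil_poly A G) CARD('d) = det G"
    unfolding pencil P_def using P[where S = UNIV] by (simp add: coeff_sum det_def)
  ultimately show ?thesis ..
qed

lemma size_gen_eigenvalues:
  fixes A G :: "complex^'d^'d"
  assumes "det G \<noteq> 0"
  shows "size (gen_eigenvalues A G) = CARD('d)"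
proof -
  have "degree (pencil_poly A G) = CARD('d)"
    using assms degree_pencil_poly_and_coeff[of A G] by (metis le_antisym le_degree)
  then show ?thesis by (simp add: gen_eigenvalues_def size_proots_complex)
qed

lemma pencil_poly_nonzero: "det G \<noteq> 0 \<Longrightarrow> pencil_poly A G \<noteq> 0"
  using degree_pencil_poly_and_coeff[of A G] by auto

section \<open>Eigenvalues as quotients of squared norms\<close>

text \<open>Pairing the eigenvector equation with \<open>c\<close> itself gives both quadratic forms
  at \<open>A\<close>; self-adjointness moves one commutator to the left argument.\<close>

lemma commutator_gen_eigenvalue:
  assumes "hermitian R" and "lin_indep_family B"
    and "z \<in># gen_eigenvalues (commutator_matrix R B) (gram_matrix B)"
  obtains A where "A \<in> cmat.span (range B)" "A \<noteq> 0"
    "z = of_real ((norm (commutator R A))\<^sup>2 / (norm A)\<^sup>2)"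
proof -
  obtain c where c: "c \<noteq> 0" "commutator_matrix R B *v c = z *s (gram_matrix B *v c)"
    using assms by (metis gen_eigenvalues_iff pencil_poly_nonzero det_gram_matrix_nonzero)
  define A where "A = lin_comb B c"
  have A: "A \<noteq> 0" using c assms by (simp add: A_def lin_comb_eq_0_iff)
  have "hs_inner (B i) (commutator R (commutator R A)) = z * hs_inner (B i) A" for i
    using c(2) by (simp add: vec_eq_iff commutator_matrix_vector gram_matrix_vector A_def)
  then have "hs_inner A (commutator R (commutator R A)) = z * hs_inner A A"
    \<comment> \<open>Only the two left arguments are expanded; the equations for the
      \<open>B i\<close> are then combined with weights \<open>cnj (c $ i)\<close>.\<close>
    by (subst (1 3) A_def) (simp add: hs_inner_lin_comb_left sum_distrib_left algebra_simps)
  then have "of_real ((norm (commutator R A))\<^sup>2) = z * of_real ((norm A)\<^sup>2)"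
    using assms(1) by (simp add: hs_inner_commutator_right hs_inner_self del: of_real_power)
  then have "z = of_real ((norm (commutator R A))\<^sup>2 / (norm A)\<^sup>2)"
    using A by (simp add: field_simps)
  then show ?thesis using that A by (auto simp: A_def span_eq_range_lin_comb)
qed

text \<open>The coordinates of a commuting \<open>A\<close> form a nonzero kernel vector of the
  commutator matrix.\<close>

lemma zero_gen_eigenvalue:
  assumes "lin_indep_family B" and "A \<in> cmat.span (range B)" "A \<noteq> 0" "R ** A = A ** R"
  shows "0 \<in># gen_eigenvalues (commutator_matrix R B) (gram_matrix B)"
proof -
  obtain c where c: "A = lin_comb B c" using assms(2) by (auto simp: span_eq_range_lin_comb)
  have "c \<noteq> 0" using assms c by (auto simp: lin_comb_eq_0_iff)
  moreover have "commutator_matrix R B *v c = 0 *s (gram_matrix B *v c)"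
  proof -
    have "commutator R (commutator R A) = 0"
      using assms(4) by (simp flip: commutator_eq_0_iff)
    then show ?thesis by (subst vec_eq_iff) (simp add: commutator_matrix_vector flip: c)
  qed
  ultimately show ?thesis
    using assms(1) by (auto simp: gen_eigenvalues_iff pencil_poly_nonzero det_gram_matrix_nonzero)
qed

text \<open>Sorting the real parts of the roots loses nothing, since every root is real.\<close>

lemma ordered_gen_eigenvalues_exist:
  fixes A G :: "complex^'d^'d"
  assumes "det G \<noteq> 0" and real: "\<And>z. z \<in># gen_eigenvalues A G \<Longrightarrow> z \<in> \<real>"
  shows "\<exists>lam. ordered_gen_eigenvalues A G lam"
proof -
  define xs where "xs = sorted_list_of_multiset (image_mset Re (gen_eigenvalues A G))"
  \<comment> \<open>List positions start at 0, eigenvalue indices at 1.\<close>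
  define lam where "lam = (\<lambda>k. xs ! (k - 1))"
  have len: "length xs = CARD('d)"
    using size_gen_eigenvalues[OF assms(1), of A] unfolding xs_def
    by (metis mset_sorted_list_of_multiset size_image_mset size_mset)
  have "mono_on {1..CARD('d)} lam"
    by (rule mono_onI) (auto simp: lam_def len xs_def intro!: sorted_nth_mono simp flip: len)
  moreover have "image_mset lam (mset_set {1..CARD('d)}) = mset xs"
  proof -
    have "mset_set {1..CARD('d)} = image_mset Suc (mset_set {..<length xs})"
      by (simp add: image_mset_mset_set len image_Suc_lessThan)
    then have "image_mset lam (mset_set {1..CARD('d)}) = image_mset ((!) xs) (mset [0..<length xs])"
      by (simp add: lam_def multiset.map_comp o_def flip: atLeast0LessThan)
    then show ?thesis by (metis map_nth mset_map)
  qed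
  then have "image_mset (\<lambda>k. complex_of_real (lam k)) (mset_set {1..CARD('d)})
      = image_mset complex_of_real (image_mset Re (gen_eigenvalues A G))"
    by (metis (no_types, lifting) multiset.map_comp comp_def multiset.map_cong0 xs_def
        mset_sorted_list_of_multiset)
  moreover have "\<dots> = image_mset id (gen_eigenvalues A G)"
    unfolding multiset.map_comp by (rule image_mset_cong) (simp add: real)
  ultimately show ?thesis by (auto simp: ordered_gen_eigenvalues_def)
qed

text \<open>The existence conjunct says that all eigenvalues are real and keeps the claims about
  every \<open>lam\<close> from being vacuous.\<close>

theorem theorem8p1:
  fixes R :: "complex^'m^'m" and B :: "'d::finite \<Rightarrow> complex^'m^'m"
  assumes "hermitian R"
    and "lin_indep_family B"
  shows "(\<exists>lam. ordered_gen_eigenvalues (commutator_matrix R B) (gram_matrix B) lam) \<and>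
    (\<forall>lam. ordered_gen_eigenvalues (commutator_matrix R B) (gram_matrix B) lam \<longrightarrow>
      (\<forall>k\<in>{1..CARD('d)}. 0 \<le> lam k) \<and>
      (lam 1 = 0 \<longleftrightarrow> (\<exists>A\<in>cmat.span (range B). A \<noteq> 0 \<and> R ** A = A ** R)) \<and>
      lam CARD('d) \<le> 4 * (spectral_norm R)\<^sup>2 \<and>
      (\<forall>\<sigma>::real. R = \<sigma>\<^sup>2 *\<^sub>R mat 1 \<longrightarrow> (\<forall>k\<in>{1..CARD('d)}. lam k = 0)))"
proof (intro conjI allI impI)
  show "\<exists>lam. ordered_gen_eigenvalues (commutator_matrix R B) (gram_matrix B) lam"
    by (intro ordered_gen_eigenvalues_exist det_gram_matrix_nonzero assms)
      (metis Reals_of_real assms commutator_gen_eigenvalue)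
next
  fix lam
  assume lam: "ordered_gen_eigenvalues (commutator_matrix R B) (gram_matrix B) lam"
  have one: "1 \<in> {1..CARD('d)}" and d: "CARD('d) \<in> {1..CARD('d)}"
    by (simp_all add: Suc_leI)
  have mono: "lam j \<le> lam k" if "j \<in> {1..CARD('d)}" "k \<in> {1..CARD('d)}" "j \<le> k" for j k
    using lam that by (auto simp: ordered_gen_eigenvalues_def mono_on_def)
  have ev: "gen_eigenvalues (commutator_matrix R B) (gram_matrix B)
      = image_mset (\<lambda>k. complex_of_real (lam k)) (mset_set {1..CARD('d)})"
    using lam by (simp add: ordered_gen_eigenvalues_def)
  have quotient: "\<exists>A\<in>cmat.span (range B). A \<noteq> 0 \<and>
      lam k = (norm (commutator R A))\<^sup>2 / (norm A)\<^sup>2" if "k \<in> {1..CARD('d)}" for k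
  proof -
    have "complex_of_real (lam k) \<in># gen_eigenvalues (commutator_matrix R B) (gram_matrix B)"
      using that by (simp add: ev)
    then show ?thesis
      by (metis assms commutator_gen_eigenvalue of_real_eq_iff)
  qed
  show nonneg: "\<forall>k\<in>{1..CARD('d)}. 0 \<le> lam k"
    using quotient by fastforce
  show "lam 1 = 0 \<longleftrightarrow> (\<exists>A\<in>cmat.span (range B). A \<noteq> 0 \<and> R ** A = A ** R)"
  proof
    assume "lam 1 = 0"
    then show "\<exists>A\<in>cmat.span (range B). A \<noteq> 0 \<and> R ** A = A ** R"
      using quotient[OF one] by (auto simp: commutator_eq_0_iff)
  next
    assume "\<exists>A\<in>cmat.span (range B). A \<noteq> 0 \<and> R ** A = A ** R"
    then have "0 \<in># gen_eigenvalues (commutator_matrix R B) (gram_matrix B)"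
      using zero_gen_eigenvalue assms(2) by blast
    then obtain k where "k \<in> {1..CARD('d)}" "lam k = 0" by (auto simp: ev)
    \<comment> \<open>The value \<open>lam 1\<close> is squeezed between \<open>0\<close> and
      \<open>lam k\<close>.\<close>
    then show "lam 1 = 0" using mono[OF one, of k] nonneg one by fastforce
  qed
  show "lam CARD('d) \<le> 4 * (spectral_norm R)\<^sup>2"
  proof -
    obtain A where A: "A \<noteq> 0" "lam CARD('d) = (norm (commutator R A))\<^sup>2 / (norm A)\<^sup>2"
      using quotient[OF d] by blast
    have "(norm (commutator R A))\<^sup>2 \<le> (2 * spectral_norm R * norm A)\<^sup>2"
      using norm_commutator_le[OF assms(1)] by (intro power_mono) auto
    then show ?thesis using A by (simp add: divide_le_eq power_mult_distrib)
  qed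
  fix \<sigma> :: real
  assume R: "R = \<sigma>\<^sup>2 *\<^sub>R mat 1"
  \<comment> \<open>A scalar matrix is central, so the numerator of every quotient vanishes.\<close>
  have "commutator R A = 0" for A
    unfolding R commutator_def
    by (simp add: matrix_scalar_ac flip: scalar_matrix_assoc)
  then show "\<forall>k\<in>{1..CARD('d)}. lam k = 0" using quotient by fastforce
qed

end
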